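(* Let $F:\mathbb{R}^n\rightrightarrows\mathbb{R}^n$ be a multifunction satisfying (F1)-(F3) of the context, with bilateral minimal time function $T$ and Hamiltonian $h$. Let $\alpha\in\mathbb{R}^n$. Then $$\widehat{\partial}^\infty T(\alpha,\alpha)=\{(\zeta,-\zeta)\in\mathbb{R}^n\times\mathbb{R}^n: h(\alpha,\zeta)\ge 0\}.$$
   Context: $\|\cdot\|$ and $\langle\cdot,\cdot\rangle$ denote the Euclidean norm and inner product (also on product spaces), and $\bar B$ the closed unit ball of $\mathbb{R}^n$. Assumptions on $F:\mathbb{R}^n\rightrightarrows\mathbb{R}^n$: (F1) $F(x)$ is nonempty, compact and convex for every $x\in\mathbb{R}^n$. (F2) $F$ is locally Lipschitz: for every compact set $K\subset\mathbb{R}^n$ there is a constant $L=L(K)$ such that $F(x)\subset F(y)+L\|y-x\|\bar B$ for all $x,y\in K$. (F3) There are positive constants $\gamma,c$ such that for all $x\in\mathbb{R}^n$, $v\in F(x)$ implies $\|v\|\le\gamma\|x\|+c$. A trajectory of $F$ is an absolutely continuous function $x(\cdot)$ with $\dot x(t)\in F(x(t))$ for a.e. $t$ in its interval of definition. The bilateral minimal time function $T:\mathbb{R}^n\times\mathbb{R}^n\to[0,+\infty]$ is $T(\alpha,\beta)=\inf\{\tau\ge 0:\text{ there is a trajectory }x(\cdot)\text{ of }F\text{ on }[0,\tau]\text{ with }x(0)=\alpha,\ x(\tau)=\beta\}$, with $T(\alpha,\beta)=+\infty$ if there is no such trajectory; in particular $T(\alpha,\alpha)=0$. The Hamiltonian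 is $h(x,p)=\min_{v\in F(x)}\langle v,p\rangle$ for $(x,p)\in\mathbb{R}^n\times\mathbb{R}^n$. For a closed set $S\subset\mathbb{R}^m$ and $x\in S$, the Fréchet normal cone $\widehat{N}_S(x)$ is the set of $\zeta\in\mathbb{R}^m$ with $\limsup_{S\ni y\to x}\frac{\langle\zeta,y-x\rangle}{\|y-x\|}\le 0$, i.e. for every $\varepsilon>0$ there is $\delta>0$ with $\langle\zeta,y-x\rangle\le\varepsilon\|y-x\|$ for all $y\in S$ with $\|y-x\|<\delta$. For $f:\mathbb{R}^m\to\mathbb{R}\cup\{+\infty\}$, $\mathrm{epi}(f)=\{(x,\mu)\in\mathbb{R}^m\times\mathbb{R}: f(x)<+\infty,\ \mu\ge f(x)\}$, and for $x$ with $f(x)<+\infty$ the Fréchet singular subdifferential is $\widehat{\partial}^\infty f(x)=\{\zeta\in\mathbb{R}^m:(\zeta,0)\in\widehat{N}_{\mathrm{epi}(f)}(x,f(x))\}$. *)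

theory Defs
  imports "HOL-Analysis.Analysis"
begin

definition F1 :: "('a::euclidean_space \<Rightarrow> 'a set) \<Rightarrow> bool" where
  "F1 F \<longleftrightarrow> (\<forall>x. F x \<noteq> {} \<and> compact (F x) \<and> convex (F x))"

definition F2 :: "('a::euclidean_space \<Rightarrow> 'a set) \<Rightarrow> bool" where
  "F2 F \<longleftrightarrow> (\<forall>K. compact K \<longrightarrow> (\<exists>L::real. \<forall>x\<in>K. \<forall>y\<in>K.
     F x \<subseteq> {w + (L * norm (y - x)) *\<^sub>R b | w b. w \<in> F y \<and> b \<in> cball 0 1}))"

definition F3 :: "('a::euclidean_space \<Rightarrow> 'a set) \<Rightarrow> bool" where
  "F3 F \<longleftrightarrow> (\<exists>\<gamma>>0. \<exists>c>0. \<forall>x. \<forall>v\<in>F x. norm v \<le> \<gamma> * norm x + c)"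

text \<open>Absolute continuity of a function of a real variable, with \<open>d division_of \<Union>d\<close> expressing
  that \<open>d\<close> is a finite family of non-overlapping compact intervals; the endpoints of
  \<open>k \<in> d\<close> are \<open>Inf k\<close> and \<open>Sup k\<close>.  (The library constant \<open>absolutely_continuous\<close> is about
  measures.)\<close>

definition abs_cont_on :: "real set \<Rightarrow> (real \<Rightarrow> 'a::real_normed_vector) \<Rightarrow> bool" where
  "abs_cont_on I f \<longleftrightarrow> (\<forall>\<epsilon>>0. \<exists>\<delta>>0. \<forall>d. d division_of \<Union>d \<and> \<Union>d \<subseteq> I \<and>
     (\<Sum>k\<in>d. Sup k - Inf k) < \<delta> \<longrightarrow> (\<Sum>k\<in>d. norm (f (Sup k) - f (Inf k))) < \<epsilon>)"

definition trajectory_on ::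
  "('a::euclidean_space \<Rightarrow> 'a set) \<Rightarrow> real set \<Rightarrow> (real \<Rightarrow> 'a) \<Rightarrow> bool" where
  "trajectory_on F I x \<longleftrightarrow> abs_cont_on I x \<and>
     (AE t in lebesgue. t \<in> I \<longrightarrow> (\<exists>v\<in>F (x t). (x has_vector_derivative v) (at t within I)))"

text \<open>In \<open>ereal\<close> the infimum of the empty set is \<open>\<infinity>\<close>.\<close>

definition min_time :: "('a::euclidean_space \<Rightarrow> 'a set) \<Rightarrow> 'a \<times> 'a \<Rightarrow> ereal" where
  "min_time F = (\<lambda>(\<alpha>, \<beta>).
     Inf {ereal \<tau> | \<tau>. \<tau> \<ge> 0 \<and> (\<exists>x. trajectory_on F {0..\<tau>} x \<and> x 0 = \<alpha> \<and> x \<tau> = \<beta>)})"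

text \<open>The minimum exists whenever \<open>F x\<close> is nonempty and compact.\<close>

definition hamiltonian :: "('a::euclidean_space \<Rightarrow> 'a set) \<Rightarrow> 'a \<Rightarrow> 'a \<Rightarrow> real" where
  "hamiltonian F x p = (LEAST r. r \<in> (\<lambda>v. v \<bullet> p) ` F x)"

definition frechet_normal_cone :: "'a::euclidean_space set \<Rightarrow> 'a \<Rightarrow> 'a set" where
  "frechet_normal_cone S x = {\<zeta>. \<forall>\<epsilon>>0. \<exists>\<delta>>0. \<forall>y\<in>S. norm (y - x) < \<delta> \<longrightarrow>
     \<zeta> \<bullet> (y - x) \<le> \<epsilon> * norm (y - x)}"

definition epi :: "('a \<Rightarrow> ereal) \<Rightarrow> ('a \<times> real) set" where
  "epi f = {(x, \<mu>). f x < \<infinity> \<and> f x \<le> ereal \<mu>}"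

text \<open>Meaningful only at points where \<open>f\<close> is finite.\<close>

definition frechet_singular_subdiff :: "('a::euclidean_space \<Rightarrow> ereal) \<Rightarrow> 'a \<Rightarrow> 'a set" where
  "frechet_singular_subdiff f x =
     {\<zeta>. (\<zeta>, 0) \<in> frechet_normal_cone (epi f) (x, real_of_ereal (f x))}"

lemma hamiltonian_is_min:
  assumes "F1 F"
  shows "\<exists>v\<in>F x. hamiltonian F x p = v \<bullet> p \<and> (\<forall>w\<in>F x. v \<bullet> p \<le> w \<bullet> p)"
proof -
  have "continuous_on (F x) (\<lambda>v. v \<bullet> p)" by (intro continuous_intros)
  then obtain v where v: "v \<in> F x" "\<forall>w\<in>F x. v \<bullet> p \<le> w \<bullet> p"
    using assms continuous_attains_inf[of "F x" "\<lambda>v. v \<bullet> p"] unfolding F1_def by blast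
  then have "hamiltonian F x p = v \<bullet> p"
    unfolding hamiltonian_def by (intro Least_equality) auto
  with v show ?thesis by blast
qed

lemma min_time_refl: "min_time F (\<alpha>, \<alpha>) = 0"
proof -
  have "trajectory_on F {0..0} (\<lambda>_. \<alpha>)"
  proof -
    have "AE t in lebesgue. t \<noteq> (0::real)"
      by (rule AE_I'[of "{0}"]) auto
    then have "AE t in lebesgue. t \<in> {0..0::real} \<longrightarrow>
        (\<exists>v\<in>F \<alpha>. ((\<lambda>_. \<alpha>) has_vector_derivative v) (at t within {0..0}))"
      by (rule eventually_mono) simp
    moreover have "abs_cont_on {0..0} (\<lambda>_. \<alpha>)"
      unfolding abs_cont_on_def by (auto intro: exI[of _ 1])
    ultimately show ?thesis
      unfolding trajectory_on_def by simp
  qed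
  then have "min_time F (\<alpha>, \<alpha>) \<le> 0"
    unfolding min_time_def by (auto intro!: Inf_lower exI[of _ "0::real"] simp: zero_ereal_def)
  moreover have "0 \<le> min_time F (\<alpha>, \<alpha>)"
    unfolding min_time_def by (auto intro!: Inf_greatest)
  ultimately show ?thesis by (rule antisym)
qed

end

theory Submission
  imports Defs "HOL-Complex_Analysis.Great_Picard"
begin

text \<open>Points of the diagonal have minimal time \<open>0\<close>, which forces a singular subgradient to have the form
  \<open>(\<zeta>, - \<zeta>)\<close>.  If \<open>v \<in> F \<alpha>\<close>, projecting \<open>v\<close> on \<open>F x\<close> yields a continuous selection, so Peano's
  theorem gives a trajectory leaving \<open>\<alpha>\<close> with velocity \<open>v\<close>; testing the normal along
  \<open>(\<alpha>, x t, t)\<close> gives \<open>\<langle>v, \<zeta>\<rangle> \<ge> 0\<close>.  Conversely, if \<open>h(\<alpha>, \<zeta>) \<ge> 0\<close>, then short trajectories from \<open>a\<close> to \<open>b\<close>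
  stay near \<open>\<alpha>\<close>, where by the Lipschitz property \<open>\<langle>v, \<zeta>\<rangle> \<ge> - \<epsilon>\<close> for all velocities, so
  \<open>\<langle>\<zeta>, a - b\<rangle> \<le> \<epsilon> T(a, b)\<close>.\<close>

section \<open>Absolutely continuous functions\<close>

lemma abs_cont_on_subset:
  assumes "abs_cont_on I f" "J \<subseteq> I"
  shows "abs_cont_on J f"
  using assms unfolding abs_cont_on_def by (meson order_trans)

text \<open>A single interval is a division of itself, so the sums in the definition reduce to one
  increment.\<close>

lemma abs_cont_on_imp_continuous_on:
  fixes f :: "real \<Rightarrow> 'a::real_normed_vector"
  assumes "abs_cont_on {a..b} f"
  shows "continuous_on {a..b} f"
proof (rule continuous_on_iff[THEN iffD2], intro ballI allI impI)
  fix s e :: real assume s: "s \<in> {a..b}" and "e > 0"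
  then obtain \<delta> where "\<delta> > 0" and \<delta>: "\<And>d. \<lbrakk>d division_of \<Union>d; \<Union>d \<subseteq> {a..b};
      (\<Sum>k\<in>d. Sup k - Inf k) < \<delta>\<rbrakk> \<Longrightarrow> (\<Sum>k\<in>d. norm (f (Sup k) - f (Inf k))) < e"
    using assms unfolding abs_cont_on_def by meson
  have *: "dist (f v) (f u) < e" if "u \<le> v" "u \<in> {a..b}" "v \<in> {a..b}" "v - u < \<delta>" for u v
  proof -
    have "{{u..v}} division_of {u..v}"
      using that division_of_self[of u v] by simp
    then show ?thesis
      using \<delta>[of "{{u..v}}"] that by (auto simp: dist_norm)
  qed
  have "dist (f t) (f s) < e" if "t \<in> {a..b}" "dist t s < \<delta>" for t
    using *[of s t] *[of t s] s that by (cases "s \<le> t") (auto simp: dist_real_def dist_commute)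
  with \<open>\<delta> > 0\<close> show "\<exists>d>0. \<forall>x'\<in>{a..b}. dist x' s < d \<longrightarrow> dist (f x') (f s) < e"
    by blast
qed

lemma lipschitz_imp_abs_cont_on:
  fixes f :: "real \<Rightarrow> 'a::real_normed_vector"
  assumes "\<And>s t. \<lbrakk>s \<in> I; t \<in> I\<rbrakk> \<Longrightarrow> norm (f t - f s) \<le> M * \<bar>t - s\<bar>"
  shows "abs_cont_on I f"
  unfolding abs_cont_on_def
proof (intro allI impI)
  fix e :: real assume "e > 0"
  \<comment> \<open>Adding 1 to \<open>\<bar>M\<bar>\<close> keeps the divisor positive, since
    \<open>M\<close> may vanish or be negative.\<close>
  define \<delta> where "\<delta> = e / (\<bar>M\<bar> + 1)"
  have "(\<Sum>k\<in>d. norm (f (Sup k) - f (Inf k))) < e"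
    if d: "d division_of \<Union>d" "\<Union>d \<subseteq> I" "(\<Sum>k\<in>d. Sup k - Inf k) < \<delta>" for d
  proof -
    have "(\<Sum>k\<in>d. norm (f (Sup k) - f (Inf k))) \<le> (\<Sum>k\<in>d. (\<bar>M\<bar> + 1) * (Sup k - Inf k))"
    proof (rule sum_mono)
      fix k assume k: "k \<in> d"
      then obtain u v where uv: "k = {u..v}" "u \<le> v"
        using division_ofD(3,4)[OF d(1) k] by force
      then have "{u..v} \<subseteq> I" using k d(2) by blast
      then have "norm (f v - f u) \<le> M * \<bar>v - u\<bar>"
        using uv by (intro assms) auto
      also have "\<dots> \<le> (\<bar>M\<bar> + 1) * (v - u)"
        using uv by (intro mult_mono) auto
      finally show "norm (f (Sup k) - f (Inf k)) \<le> (\<bar>M\<bar> + 1) * (Sup k - Inf k)"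
        using uv by simp
    qed
    also have "\<dots> = (\<bar>M\<bar> + 1) * (\<Sum>k\<in>d. Sup k - Inf k)"
      by (simp add: sum_distrib_left)
    also have "\<dots> < (\<bar>M\<bar> + 1) * \<delta>"
      using d(3) by (intro mult_strict_left_mono) auto
    also have "\<dots> = e" by (simp add: \<delta>_def add_nonneg_eq_0_iff)
    finally show ?thesis .
  qed
  moreover have "\<delta> > 0" using \<open>e > 0\<close> by (simp add: \<delta>_def add_nonneg_pos)
  ultimately show "\<exists>\<delta>>0. \<forall>d. d division_of \<Union>d \<and> \<Union>d \<subseteq> I \<and> (\<Sum>k\<in>d. Sup k - Inf k) < \<delta> \<longrightarrow>
      (\<Sum>k\<in>d. norm (f (Sup k) - f (Inf k))) < e" by blast
qed

text \<open>Distinct pairs have intervals with disjoint interiors, so an interval carrying two tags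
  is a single point and contributes 0. This links sums over tagged divisions with the untagged sums
  in \<open>abs_cont_on\<close>.\<close>

lemma sum_tags_eq_sum_intervals:
  fixes g :: "real set \<Rightarrow> real"
  assumes p: "p tagged_partial_division_of S"
    and "\<And>u. g {u} = 0"
  shows "(\<Sum>(t, k)\<in>p. g k) = (\<Sum>k\<in>snd ` p. g k)"
proof -
  \<comment> \<open>The summation rule wants the value 0 on every box with empty interior, the empty
    box included, whereas \<open>g\<close> is known to vanish only on singletons.\<close>
  define d where "d k = (if k = {} then 0 else g k)" for k
  have ne: "k \<noteq> {}" if "(t, k) \<in> p" for t k
    using tagged_partial_division_ofD(2)[OF p that] by blast
  have "(\<Sum>(t, k)\<in>p. g k) = (\<Sum>(t, k)\<in>p. d k)"
    using ne by (intro sum.cong) (auto simp: d_def)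
  also have "\<dots> = (\<Sum>k\<in>snd ` p. d k)"
  proof (rule sum.over_tagged_division_lemma[OF tagged_partial_division_of_Union_self[OF p]])
    fix u v :: real assume "box u v = {}"
    then show "d (cbox u v) = 0"
      using assms(2) by (cases "u = v") (auto simp: d_def)
  qed
  also have "\<dots> = (\<Sum>k\<in>snd ` p. g k)"
    using ne by (intro sum.cong) (auto simp: d_def)
  finally show ?thesis .
qed

lemma sum_lengths_le_measure:
  fixes U :: "real set"
  assumes d: "d division_of \<Union>d" and U: "\<Union>d \<subseteq> U" "U \<in> lmeasurable"
  shows "(\<Sum>k\<in>d. Sup k - Inf k) \<le> measure lebesgue U"
proof -
  have "(\<Sum>k\<in>d. Sup k - Inf k) = (\<Sum>k\<in>d. measure lebesgue k)"
  proof (rule sum.cong)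
    fix k assume "k \<in> d"
    then obtain u v where "k = {u..v}" "u \<le> v"
      using division_ofD(3,4)[OF d] by force
    then show "Sup k - Inf k = measure lebesgue k" by simp
  qed simp
  also have "\<dots> = measure lebesgue (\<Union>d)"
    by (rule content_division[OF d])
  also have "\<dots> \<le> measure lebesgue U"
    using U lmeasurable_division[OF d] by (intro measure_mono_fmeasurable) auto
  finally show ?thesis .
qed

text \<open>A gauge argument: near a point of differentiability the increment of \<open>x\<close> is controlled by the
  derivative, while the intervals tagged by exceptional points lie in an open set of small
  measure, where absolute continuity applies.\<close>

lemma abs_cont_on_inner_increment_le:
  fixes x :: "real \<Rightarrow> 'a::euclidean_space"
  assumes ab: "a \<le> b" and AC: "abs_cont_on {a..b} x"
    and der: "AE t in lebesgue. t \<in> {a..b} \<longrightarrow>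
      (\<exists>v. (x has_vector_derivative v) (at t within {a..b}) \<and> w \<bullet> v \<le> K)"
  shows "w \<bullet> (x b - x a) \<le> K * (b - a)"
proof -
  obtain N where N: "N \<in> null_sets lebesgue" and
    derN: "\<And>t. \<lbrakk>t \<in> {a..b}; t \<notin> N\<rbrakk> \<Longrightarrow>
      \<exists>v. (x has_vector_derivative v) (at t within {a..b}) \<and> w \<bullet> v \<le> K"
    by (rule AE_E3[OF der]) auto
  \<comment> \<open>The three error terms come from the differentiation error, from the length lost
    to the exceptional intervals, and from the increments over those intervals.\<close>
  have main: "w \<bullet> (x b - x a) \<le> K * (b - a) + e * (norm w * (b - a) + \<bar>K\<bar> + norm w)"
    if "e > 0" for e
  proof -
    obtain \<delta>0 where "\<delta>0 > 0" and \<delta>0: "\<And>d. \<lbrakk>d division_of \<Union>d; \<Union>d \<subseteq> {a..b};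
        (\<Sum>k\<in>d. Sup k - Inf k) < \<delta>0\<rbrakk> \<Longrightarrow> (\<Sum>k\<in>d. norm (x (Sup k) - x (Inf k))) < e"
      using AC \<open>e > 0\<close> unfolding abs_cont_on_def by meson
    \<comment> \<open>Below \<open>\<delta>0\<close> absolute continuity bounds the exceptional
      increments; below \<open>e\<close> the exceptional length itself is negligible.\<close>
    define \<delta> where "\<delta> = min \<delta>0 e"
    have "\<delta> > 0" using \<open>\<delta>0 > 0\<close> \<open>e > 0\<close> by (simp add: \<delta>_def)
    obtain U where U: "open U" "N \<subseteq> U" "U - N \<in> lmeasurable" "emeasure lebesgue (U - N) < ennreal \<delta>"
      using sets_lebesgue_outer_open[OF null_setsD2[OF N] \<open>\<delta> > 0\<close>] by blast
    have Ueq: "emeasure lebesgue (U - N) = emeasure lebesgue U"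
      using N U(1) by (intro emeasure_Diff_null_set) auto
    have Um: "U \<in> lmeasurable"
      using U Ueq by (auto simp: fmeasurable_def)
    have Umeas: "measure lebesgue U < \<delta>"
      using U(4) Ueq Um \<open>\<delta> > 0\<close> by (simp add: emeasure_eq_measure2 ennreal_less_iff)
    \<comment> \<open>The radius of the gauge: inside \<open>U\<close> at exceptional points, and
      small enough for the differential estimate elsewhere. The estimate is for intervals containing
      the tag, where the errors on the two sides add up to \<open>e * (z - y)\<close>.\<close>
    have "\<exists>r>0. (t \<in> N \<longrightarrow> ball t r \<subseteq> U) \<and>
        (t \<in> {a..b} - N \<longrightarrow> (\<forall>y z. y \<in> ball t r \<and> z \<in> ball t r \<and> y \<in> {a..b} \<and> z \<in> {a..b} \<and> y \<le> t \<and> t \<le> z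
          \<longrightarrow> w \<bullet> (x z - x y) \<le> (K + norm w * e) * (z - y)))" for t
    proof -
      consider "t \<in> N" | "t \<in> {a..b} - N" | "t \<notin> N \<and> t \<notin> {a..b}" by blast
      then show ?thesis
      proof cases
        case 1
        then show ?thesis using U by (metis DiffD2 open_contains_ball subsetD)
      next
        case 2
        then obtain v where v: "(x has_vector_derivative v) (at t within {a..b})" "w \<bullet> v \<le> K"
          using derN by blast
        then obtain r where "r > 0" and r: "\<And>y. \<lbrakk>y \<in> {a..b}; \<bar>y - t\<bar> < r\<rbrakk> \<Longrightarrow>
            norm (x y - x t - (y - t) *\<^sub>R v) \<le> e * \<bar>y - t\<bar>"
          using \<open>e > 0\<close> unfolding has_vector_derivative_def has_derivative_within_alt by (metis real_norm_def)
        have "w \<bullet> (x z - x y) \<le> (K + norm w * e) * (z - y)"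
          if "y \<in> ball t r" "z \<in> ball t r" "y \<in> {a..b}" "z \<in> {a..b}" "y \<le> t" "t \<le> z" for y z
        proof -
          have "norm ((x z - x t - (z - t) *\<^sub>R v) - (x y - x t - (y - t) *\<^sub>R v))
              \<le> e * \<bar>z - t\<bar> + e * \<bar>y - t\<bar>"
            using that by (intro order_trans[OF norm_triangle_ineq4] add_mono r)
              (auto simp: dist_real_def)
          also have "\<dots> = e * (z - y)" using that by (simp add: algebra_simps)
          also have "(x z - x t - (z - t) *\<^sub>R v) - (x y - x t - (y - t) *\<^sub>R v) = x z - x y - (z - y) *\<^sub>R v"
            by (simp add: algebra_simps)
          finally have "norm (x z - x y - (z - y) *\<^sub>R v) \<le> e * (z - y)" .
          then have "w \<bullet> (x z - x y - (z - y) *\<^sub>R v) \<le> norm w * (e * (z - y))"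
            by (meson norm_cauchy_schwarz mult_left_mono norm_ge_zero order_trans)
          moreover have "(z - y) * (w \<bullet> v) \<le> (z - y) * K"
            using v(2) that by (intro mult_left_mono) auto
          ultimately show ?thesis by (simp add: inner_diff_right algebra_simps)
        qed
        then show ?thesis using \<open>r > 0\<close> 2 by blast
      next
        case 3
        then show ?thesis by (intro exI[of _ 1]) auto
      qed
    qed
    then obtain r where r: "\<And>t. r t > 0" "\<And>t. t \<in> N \<Longrightarrow> ball t (r t) \<subseteq> U"
      "\<And>t y z. \<lbrakk>t \<in> {a..b}; t \<notin> N; y \<in> ball t (r t); z \<in> ball t (r t); y \<in> {a..b}; z \<in> {a..b}; y \<le> t; t \<le> z\<rbrakk>
          \<Longrightarrow> w \<bullet> (x z - x y) \<le> (K + norm w * e) * (z - y)"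
      by (metis DiffI)
    have "gauge (\<lambda>t. ball t (r t))" using r(1) by (simp add: gauge_def)
    then obtain p where p: "p tagged_division_of {a..b}" "(\<lambda>t. ball t (r t)) fine p"
      using fine_division_exists_real by blast
    define q where "q = {(t, k) \<in> p. t \<in> N}"
    have qp: "q \<subseteq> p" by (auto simp: q_def)
    have fin: "finite p" "finite q"
      using p(1) qp finite_subset by auto
    have pp: "p tagged_partial_division_of {a..b}"
      using p(1) by (simp add: tagged_division_of_def)
    have qpart: "q tagged_partial_division_of {a..b}"
      using tagged_partial_division_subset[OF pp qp] .
    define d where "d = snd ` q"
    have d: "d division_of \<Union>d"
      unfolding d_def using partial_division_of_tagged_division[OF qpart] .
    have dab: "\<Union>d \<subseteq> {a..b}"
      using tagged_partial_division_ofD(3)[OF qpart] by (force simp: d_def)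
    have dU: "\<Union>d \<subseteq> U"
      using p(2) r(2) by (fastforce simp: d_def q_def fine_def)
    have dlen: "(\<Sum>k\<in>d. Sup k - Inf k) < \<delta>"
      using sum_lengths_le_measure[OF d dU Um] Umeas by simp
    have ends: "\<exists>y z. k = {y..z} \<and> y \<le> t \<and> t \<le> z \<and> y \<in> {a..b} \<and> z \<in> {a..b} \<and> y \<in> ball t (r t) \<and> z \<in> ball t (r t)
        \<and> t \<in> {a..b}" if tk: "(t, k) \<in> p" for t k
    proof -
      obtain y z where k: "k = cbox y z" using tagged_division_ofD(4)[OF p(1) tk] by blast
      have "t \<in> k" "k \<subseteq> {a..b}" "k \<subseteq> ball t (r t)"
        using tagged_division_ofD(2,3)[OF p(1) tk] p(2) tk by (auto simp: fine_def)
      moreover from this have "y \<in> k" "z \<in> k" using k by auto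
      moreover have "y \<le> t" "t \<le> z" "k = {y..z}" using k \<open>t \<in> k\<close> by auto
      ultimately show ?thesis by blast
    qed
    \<comment> \<open>The total length of the intervals with exceptional tags; the good intervals
      fill the remaining \<open>b - a - l\<close>.\<close>
    define l where "l = (\<Sum>(t, k)\<in>q. Sup k - Inf k)"
    have l: "l = (\<Sum>k\<in>d. Sup k - Inf k)"
      unfolding l_def d_def by (rule sum_tags_eq_sum_intervals[OF qpart]) simp
    have l0: "l \<ge> 0"
      unfolding l_def using ends qp by (intro sum_nonneg) force
    have ltot: "(\<Sum>(t, k)\<in>p. Sup k - Inf k) = b - a"
      using additive_tagged_division_1[OF ab p(1), of "\<lambda>t. t"] by simp
    have lpq: "(\<Sum>(t, k)\<in>p - q. Sup k - Inf k) = b - a - l"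
      using sum.subset_diff[OF qp fin(1), of "\<lambda>(t, k). Sup k - Inf k"] ltot l_def by simp
    have "w \<bullet> (x b - x a) = (\<Sum>(t, k)\<in>p. w \<bullet> (x (Sup k) - x (Inf k)))"
      using additive_tagged_division_1[OF ab p(1), of "\<lambda>t. w \<bullet> x t"] by (simp add: inner_diff_right)
    also have "\<dots> = (\<Sum>(t, k)\<in>p - q. w \<bullet> (x (Sup k) - x (Inf k))) + (\<Sum>(t, k)\<in>q. w \<bullet> (x (Sup k) - x (Inf k)))"
      by (rule sum.subset_diff[OF qp fin(1)])
    also have "(\<Sum>(t, k)\<in>p - q. w \<bullet> (x (Sup k) - x (Inf k))) \<le> (\<Sum>(t, k)\<in>p - q. (K + norm w * e) * (Sup k - Inf k))"
    proof (rule sum_mono, clarify)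
      fix t k assume tk: "(t, k) \<in> p" "(t, k) \<notin> q"
      then have "t \<notin> N" by (auto simp: q_def)
      then show "w \<bullet> (x (Sup k) - x (Inf k)) \<le> (K + norm w * e) * (Sup k - Inf k)"
        using ends[OF tk(1)] r(3)[of t] by force
    qed
    also have "\<dots> = (K + norm w * e) * (b - a - l)"
      by (simp add: split_def flip: sum_distrib_left lpq)
    also have "(\<Sum>(t, k)\<in>q. w \<bullet> (x (Sup k) - x (Inf k))) \<le> (\<Sum>(t, k)\<in>q. norm w * norm (x (Sup k) - x (Inf k)))"
      by (rule sum_mono) (auto simp: norm_cauchy_schwarz)
    also have "\<dots> = norm w * (\<Sum>(t, k)\<in>q. norm (x (Sup k) - x (Inf k)))"
      by (simp add: split_def sum_distrib_left)
    also have "(\<Sum>(t, k)\<in>q. norm (x (Sup k) - x (Inf k))) = (\<Sum>k\<in>d. norm (x (Sup k) - x (Inf k)))"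
      unfolding d_def by (rule sum_tags_eq_sum_intervals[OF qpart]) simp
    also have "norm w * \<dots> \<le> norm w * e"
      using \<delta>0[OF d dab] dlen by (intro mult_left_mono) (auto simp: \<delta>_def)
    finally have "w \<bullet> (x b - x a) \<le> (K + norm w * e) * (b - a - l) + norm w * e" by simp
    also have "\<dots> = K * (b - a) - K * l + norm w * e * (b - a - l) + norm w * e"
      by (simp add: algebra_simps)
    also have "\<dots> \<le> K * (b - a) + \<bar>K\<bar> * e + norm w * e * (b - a) + norm w * e"
    proof -
      \<comment> \<open>For negative \<open>K\<close> the missing length \<open>l\<close> makes the
        bound worse, by at most \<open>\<bar>K\<bar> * e\<close>.\<close>
      have "- (K * l) \<le> \<bar>K\<bar> * l" using l0 by (metis abs_ge_minus_self mult_minus_left mult_right_mono)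
      also have "\<dots> \<le> \<bar>K\<bar> * e" using dlen l by (intro mult_left_mono) (auto simp: \<delta>_def)
      finally have "- (K * l) \<le> \<bar>K\<bar> * e" .
      moreover have "norm w * e * (b - a - l) \<le> norm w * e * (b - a)"
        using l0 \<open>e > 0\<close> by (intro mult_left_mono) auto
      ultimately show ?thesis by linarith
    qed
    finally show ?thesis by (simp add: algebra_simps)
  qed
  define C where "C = norm w * (b - a) + \<bar>K\<bar> + norm w"
  have "C \<ge> 0" using ab by (simp add: C_def)
  show ?thesis
  proof (rule field_le_epsilon)
    fix e :: real assume "e > 0"
    have "w \<bullet> (x b - x a) \<le> K * (b - a) + e / (C + 1) * C"
      using main[of "e / (C + 1)"] \<open>e > 0\<close> \<open>C \<ge> 0\<close> by (simp add: C_def)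
    also have "e / (C + 1) * C \<le> e"
      using \<open>e > 0\<close> \<open>C \<ge> 0\<close> by (simp add: field_simps)
    finally show "w \<bullet> (x b - x a) \<le> K * (b - a) + e" by simp
  qed
qed

text \<open>Apply the scalar estimate in the direction of the increment itself and divide by its
  norm.\<close>

lemma abs_cont_on_norm_increment_le:
  fixes x :: "real \<Rightarrow> 'a::euclidean_space"
  assumes "a \<le> b" and "abs_cont_on {a..b} x" and "0 \<le> M"
    and der: "AE t in lebesgue. t \<in> {a..b} \<longrightarrow>
      (\<exists>v. (x has_vector_derivative v) (at t within {a..b}) \<and> norm v \<le> M)"
  shows "norm (x b - x a) \<le> M * (b - a)"
proof (cases "x b = x a")
  case False
  define w where "w = x b - x a"
  have "w \<bullet> (x b - x a) \<le> norm w * M * (b - a)"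
  proof (rule abs_cont_on_inner_increment_le[OF assms(1,2)])
    show "AE t in lebesgue. t \<in> {a..b} \<longrightarrow>
        (\<exists>v. (x has_vector_derivative v) (at t within {a..b}) \<and> w \<bullet> v \<le> norm w * M)"
      using der by (rule eventually_mono) (meson mult_left_mono norm_cauchy_schwarz norm_ge_zero order_trans)
  qed
  then have "norm w * norm w \<le> norm w * (M * (b - a))"
    by (simp add: w_def power2_norm_eq_inner[symmetric] power2_eq_square)
  moreover have "norm w > 0" using False by (simp add: w_def)
  ultimately show ?thesis by (simp add: w_def)
qed (use assms in auto)

section \<open>Peano's existence theorem\<close>

lemma integral_lipschitz_upper_limit:
  fixes \<phi> :: "real \<Rightarrow> 'a::euclidean_space"
  assumes cont: "continuous_on UNIV \<phi>" and bound: "\<And>s. norm (\<phi> s) \<le> M"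
  shows "norm (integral {0..t} \<phi> - integral {0..s} \<phi>) \<le> M * \<bar>t - s\<bar>"
proof -
  have M: "0 \<le> M" using bound[of 0] norm_ge_zero order_trans by blast
  have int: "\<phi> integrable_on {a..b}" for a b
    using cont continuous_on_subset by (intro integrable_continuous_real) blast
  have bd: "norm (integral {a..b} \<phi>) \<le> M * (b - a)" if "a \<le> b" for a b
    using integral_bound[OF that continuous_on_subset[OF cont] bound] by auto
  have le: "norm (integral {0..t} \<phi> - integral {0..s} \<phi>) \<le> M * (t - s)" if "s \<le> t" for s t
  proof -
    consider "t \<le> 0" | "s \<le> 0" "0 \<le> t" | "0 \<le> s" by linarith
    then show ?thesis
    proof cases
      case 1
      have *: "integral {0..r} \<phi> = 0" if "r \<le> 0" for r
        using that by (cases "r = 0") auto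
      show ?thesis using *[of s] *[of t] 1 that M by simp
    next
      case 2
      have *: "integral {0..s} \<phi> = 0"
        using 2 by (cases "s = 0") auto
      have "norm (integral {0..t} \<phi>) \<le> M * t" using bd[of 0 t] 2 by simp
      also have "\<dots> \<le> M * (t - s)" using 2 M by (intro mult_left_mono) auto
      finally show ?thesis using * by simp
    next
      case 3
      have "integral {0..t} \<phi> - integral {0..s} \<phi> = integral {s..t} \<phi>"
        using Henstock_Kurzweil_Integration.integral_combine[OF 3 that int] by (simp add: algebra_simps)
      then show ?thesis using bd[OF that] by simp
    qed
  qed
  show ?thesis
    using le[of s t] le[of t s] by (cases "s \<le> t") (auto simp: norm_minus_commute)
qed

text \<open>Tonelli's approximations: the delay \<open>h\<close> makes the integral equation explicit, so that the
  \<open>j\<close>-th iterate already solves it on \<open>{..j * h}\<close>.\<close>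

lemma delayed_integral_equation:
  fixes g :: "'a::euclidean_space \<Rightarrow> 'a"
  assumes cont: "continuous_on UNIV g" and bound: "\<And>x. norm (g x) \<le> M" and "h > 0"
  shows "\<exists>y. (\<forall>s t. norm (y t - y s) \<le> M * \<bar>t - s\<bar>) \<and> y 0 = \<alpha> \<and>
    (\<forall>t\<in>{0..1}. y t = \<alpha> + integral {0..t} (\<lambda>s. g (y (s - h))))"
proof -
  have M: "0 \<le> M" using bound[of 0] norm_ge_zero order_trans by blast
  define y where "y = rec_nat (\<lambda>_. \<alpha>) (\<lambda>_ z t. \<alpha> + integral {0..t} (\<lambda>s. g (z (s - h))))"
  have y0: "y 0 = (\<lambda>_. \<alpha>)" and yS: "\<And>j. y (Suc j) = (\<lambda>t. \<alpha> + integral {0..t} (\<lambda>s. g (y j (s - h))))"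
    by (simp_all add: y_def)
  have lip: "norm (y j t - y j s) \<le> M * \<bar>t - s\<bar>" for j s t
  proof (induction j arbitrary: s t)
    case 0
    then show ?case using M by (simp add: y0)
  next
    case (Suc j)
    have "M-lipschitz_on UNIV (y j)"
      using Suc.IH M by (intro lipschitz_onI) (auto simp: dist_norm)
    then have yj: "continuous_on UNIV (y j)" by (rule lipschitz_on_continuous_on)
    have "continuous_on UNIV (\<lambda>s. y j (s - h))"
      by (rule continuous_on_compose2[OF yj continuous_on_diff[OF continuous_on_id continuous_on_const]]) simp
    then have "continuous_on UNIV (\<lambda>s. g (y j (s - h)))"
      by (rule continuous_on_compose2[OF cont]) auto
    from integral_lipschitz_upper_limit[OF this bound] show ?case by (simp add: yS)
  qed
  \<comment> \<open>For \<open>t \<le> 0\<close> the integral over \<open>{0..t}\<close> vanishes,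
    so every iterate has the constant history \<open>\<alpha>\<close> that the delay reads.\<close>
  have nonpos: "y j t = \<alpha>" if "t \<le> 0" for j t
    using that by (cases j; cases "t = 0") (auto simp: y0 yS)
  have stable: "y (Suc j) t = y j t" if "t \<le> j * h" for j t
    using that
  proof (induction j arbitrary: t)
    case 0
    then show ?case by (simp add: nonpos)
  next
    case (Suc j)
    \<comment> \<open>The delay moves \<open>s \<le> Suc j * h\<close> back to at most
      \<open>j * h\<close>, where the iterates already agree.\<close>
    have "y (Suc j) (s - h) = y j (s - h)" if "s \<in> {0..t}" for s
      using that Suc.prems by (intro Suc.IH) (auto simp: algebra_simps)
    then have "integral {0..t} (\<lambda>s. g (y (Suc j) (s - h))) = integral {0..t} (\<lambda>s. g (y j (s - h)))"
      by (intro integral_cong) simp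
    then show ?case by (simp add: yS)
  qed
  obtain n where n: "1 / h \<le> real n" using real_arch_simple by blast
  then have "1 \<le> n * h" using \<open>h > 0\<close> by (simp add: field_simps)
  then have "y n t = \<alpha> + integral {0..t} (\<lambda>s. g (y n (s - h)))" if "t \<in> {0..1}" for t
    using stable[of t n] that by (simp add: yS)
  then show ?thesis using lip nonpos[of 0] by (intro exI[of _ "y n"]) auto
qed

text \<open>Solutions with delays tending to 0 share one Lipschitz constant, so Arzela-Ascoli yields
  a uniformly convergent subsequence. Passing to the limit in the integral equation removes the
  delay, and differentiating gives the equation for \<open>x\<close>.\<close>

theorem Peano_existence:
  fixes g :: "'a::euclidean_space \<Rightarrow> 'a"
  assumes cont: "continuous_on UNIV g" and bound: "\<And>x. norm (g x) \<le> M"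
  obtains x where "x 0 = \<alpha>"
    "\<And>t. t \<in> {0..1} \<Longrightarrow> (x has_vector_derivative g (x t)) (at t within {0..1})"
proof -
  have M: "0 \<le> M" using bound[of 0] norm_ge_zero order_trans by blast
  define h where "h k = inverse (real (Suc k))" for k
  have h: "h k > 0" for k by (simp add: h_def)
  have "\<forall>k. \<exists>y. (\<forall>s t. norm (y t - y s) \<le> M * \<bar>t - s\<bar>) \<and> y 0 = \<alpha> \<and>
    (\<forall>t\<in>{0..1}. y t = \<alpha> + integral {0..t} (\<lambda>s. g (y (s - h k))))"
    using delayed_integral_equation[OF cont bound h] by blast
  then obtain y where lip: "\<And>k s t. norm (y k t - y k s) \<le> M * \<bar>t - s\<bar>" and y0: "\<And>k. y k 0 = \<alpha>"
    and eq: "\<And>k t. t \<in> {0..1} \<Longrightarrow> y k t = \<alpha> + integral {0..t} (\<lambda>s. g (y k (s - h k)))"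
    by metis
  have conty: "continuous_on UNIV (y k)" for k
  proof -
    have "M-lipschitz_on UNIV (y k)"
      using lip M by (intro lipschitz_onI) (auto simp: dist_norm)
    then show ?thesis by (rule lipschitz_on_continuous_on)
  qed
  \<comment> \<open>The range reaches down to -1 because delayed times \<open>t - h k\<close> with
    \<open>h k \<le> 1\<close> occur.\<close>
  have ybd: "norm (y k t) \<le> norm \<alpha> + M" if "\<bar>t\<bar> \<le> 1" for k t
  proof -
    have "norm (y k t) \<le> norm (y k 0) + norm (y k t - y k 0)" by (rule norm_triangle_sub)
    also have "norm (y k t - y k 0) \<le> M * \<bar>t - 0\<bar>" by (rule lip)
    also have "\<dots> \<le> M * 1" using that M by (intro mult_left_mono) auto
    finally show ?thesis by (simp add: y0)
  qed
  obtain x \<kappa> where contx: "continuous_on {0..1} x" and \<kappa>: "strict_mono (\<kappa> :: nat \<Rightarrow> nat)"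
    and conv: "\<And>e. 0 < e \<Longrightarrow> \<exists>N. \<forall>n t. n \<ge> N \<and> t \<in> {0..1} \<longrightarrow> norm (y (\<kappa> n) t - x t) < e"
  proof (rule Arzela_Ascoli[of "{0..1::real}" y "norm \<alpha> + M"])
    fix t e :: real assume "e > 0"
    show "\<exists>d>0. \<forall>n s. s \<in> {0..1} \<and> norm (t - s) < d \<longrightarrow> norm (y n t - y n s) < e"
    proof (intro exI[of _ "e / (M + 1)"] conjI allI impI)
      show "0 < e / (M + 1)" using \<open>e > 0\<close> M by simp
      fix n s assume "s \<in> {0..1} \<and> norm (t - s) < e / (M + 1)"
      then have "(M + 1) * \<bar>t - s\<bar> < e" using M by (simp add: field_simps)
      moreover have "M * \<bar>t - s\<bar> \<le> (M + 1) * \<bar>t - s\<bar>" by (intro mult_right_mono) auto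
      ultimately show "norm (y n t - y n s) < e" using lip[of n t s] by simp
    qed
  qed (use ybd in auto)
  define B where "B = cball (0::'a) (norm \<alpha> + M)"
  have ucont: "uniformly_continuous_on B g"
    unfolding B_def using cont by (intro compact_uniformly_continuous) (auto intro: continuous_on_subset)
  have lim: "(\<lambda>n. y (\<kappa> n) t) \<longlonglongrightarrow> x t" if "t \<in> {0..1}" for t
    unfolding LIMSEQ_iff
  proof (intro allI impI)
    fix e :: real assume "e > 0"
    then obtain N where "\<forall>n t. n \<ge> N \<and> t \<in> {0..1} \<longrightarrow> norm (y (\<kappa> n) t - x t) < e"
      using conv by meson
    then show "\<exists>N. \<forall>n\<ge>N. norm (y (\<kappa> n) t - x t) < e"
      using that by (intro exI[of _ N]) simp
  qed
  have xB: "x t \<in> B" if "t \<in> {0..1}" for t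
  proof -
    have "norm (x t) \<le> norm \<alpha> + M"
      by (rule LIMSEQ_le_const2[OF tendsto_norm[OF lim[OF that]]]) (use that ybd in auto)
    then show ?thesis by (simp add: B_def)
  qed
  have yB: "y k (t - h k) \<in> B" if "t \<in> {0..1}" for k t
  proof -
    have "h k \<le> 1" by (simp add: h_def field_simps)
    then have "\<bar>t - h k\<bar> \<le> 1" using that h[of k] by (auto simp: abs_le_iff)
    then show ?thesis using ybd by (simp add: B_def)
  qed
  \<comment> \<open>The distance to \<open>x s\<close> splits into the effect of the delay, at most
    \<open>M * h (\<kappa> n)\<close>, and the uniform error of the subsequence; uniform continuity
    of \<open>g\<close> on the compact set \<open>B\<close> transfers this to the
    integrands.\<close>
  have unif: "uniform_limit {0..1} (\<lambda>n s. g (y (\<kappa> n) (s - h (\<kappa> n)))) (\<lambda>s. g (x s)) sequentially"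
    unfolding uniform_limit_sequentially_iff
  proof (intro allI impI)
    fix e :: real assume "e > 0"
    then obtain d where "d > 0" and d: "\<And>p q. \<lbrakk>p \<in> B; q \<in> B; dist p q < d\<rbrakk> \<Longrightarrow> dist (g p) (g q) < e"
      using uniformly_continuous_onE[OF ucont \<open>e > 0\<close>] by (metis dist_commute)
    obtain N1 where N1: "\<And>n t. \<lbrakk>n \<ge> N1; t \<in> {0..1}\<rbrakk> \<Longrightarrow> norm (y (\<kappa> n) t - x t) < d / 2"
      using conv[of "d / 2"] \<open>d > 0\<close> by auto
    have "(\<lambda>n. M * h (\<kappa> n)) \<longlonglongrightarrow> M * 0"
      using LIMSEQ_subseq_LIMSEQ[OF LIMSEQ_inverse_real_of_nat \<kappa>]
      by (intro tendsto_intros) (simp add: h_def o_def)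
    then have "\<forall>\<^sub>F n in sequentially. M * h (\<kappa> n) < d / 2"
      using \<open>d > 0\<close> by (intro order_tendstoD) auto
    then obtain N2 where N2: "\<And>n. n \<ge> N2 \<Longrightarrow> M * h (\<kappa> n) < d / 2"
      unfolding eventually_sequentially by blast
    have "dist (g (y (\<kappa> n) (t - h (\<kappa> n)))) (g (x t)) < e" if "n \<ge> max N1 N2" "t \<in> {0..1}" for n t
    proof (rule d[OF yB[OF that(2)] xB[OF that(2)]])
      have "norm (y (\<kappa> n) (t - h (\<kappa> n)) - y (\<kappa> n) t) \<le> M * h (\<kappa> n)"
        using lip[of "\<kappa> n" "t - h (\<kappa> n)" t] h[of "\<kappa> n"] by simp
      moreover have "norm (y (\<kappa> n) t - x t) < d / 2" "M * h (\<kappa> n) < d / 2"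
        using N1[of n t] N2[of n] that by auto
      ultimately show "dist (y (\<kappa> n) (t - h (\<kappa> n))) (x t) < d"
        unfolding dist_norm
        using norm_triangle_ineq[of "y (\<kappa> n) (t - h (\<kappa> n)) - y (\<kappa> n) t" "y (\<kappa> n) t - x t"] by simp
    qed
    then show "\<exists>N. \<forall>n\<ge>N. \<forall>t\<in>{0..1}. dist (g (y (\<kappa> n) (t - h (\<kappa> n)))) (g (x t)) < e"
      by blast
  qed
  have xeq: "x t = \<alpha> + integral {0..t} (\<lambda>s. g (x s))" if t: "t \<in> {0..1}" for t
  proof -
    have "uniform_limit {0..t} (\<lambda>n s. g (y (\<kappa> n) (s - h (\<kappa> n)))) (\<lambda>s. g (x s)) sequentially"
      using t by (intro uniform_limit_on_subset[OF unif]) auto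
    moreover have "continuous_on {0..t} (\<lambda>s. g (y (\<kappa> n) (s - h (\<kappa> n))))" for n
    proof -
      have "continuous_on {0..t} (\<lambda>s. y (\<kappa> n) (s - h (\<kappa> n)))"
        by (rule continuous_on_compose2[OF conty continuous_on_diff[OF continuous_on_id continuous_on_const]]) simp
      then show ?thesis by (rule continuous_on_compose2[OF cont]) auto
    qed
    ultimately obtain I J where IJ: "\<And>n. ((\<lambda>s. g (y (\<kappa> n) (s - h (\<kappa> n)))) has_integral I n) {0..t}"
      "((\<lambda>s. g (x s)) has_integral J) {0..t}" "I \<longlonglongrightarrow> J"
      by (rule uniform_limit_integral) auto
    have "y (\<kappa> n) t = \<alpha> + I n" for n
      using eq[OF t, of "\<kappa> n"] integral_unique[OF IJ(1)] by simp
    then have "(\<lambda>n. y (\<kappa> n) t) \<longlonglongrightarrow> \<alpha> + J"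
      using IJ(3) by (simp add: tendsto_add)
    then show ?thesis
      using LIMSEQ_unique[OF lim[OF t]] integral_unique[OF IJ(2)] by simp
  qed
  show ?thesis
  proof (rule that[of x])
    show "x 0 = \<alpha>" using xeq[of 0] by simp
    fix t :: real assume t: "t \<in> {0..1}"
    have "continuous_on {0..1} (\<lambda>s. g (x s))"
      by (rule continuous_on_compose2[OF cont contx]) simp
    from integral_has_vector_derivative[OF this t]
    have "((\<lambda>u. \<alpha> + integral {0..u} (\<lambda>s. g (x s))) has_vector_derivative g (x t)) (at t within {0..1})"
      by (auto intro!: derivative_eq_intros)
    then show "(x has_vector_derivative g (x t)) (at t within {0..1})"
      using xeq by (rule has_vector_derivative_transform[OF t, rotated])
  qed
qed

section \<open>Trajectories and the minimal time function\<close>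

text \<open>Turns the inclusion into a choice of a nearby velocity; passing to
  \<open>\<bar>L\<bar>\<close> makes the constant nonnegative.\<close>

lemma F2_E:
  assumes "F2 F" "compact K"
  obtains L where "0 \<le> L"
    "\<And>x y v. \<lbrakk>x \<in> K; y \<in> K; v \<in> F x\<rbrakk> \<Longrightarrow> \<exists>w\<in>F y. norm (v - w) \<le> L * norm (y - x)"
proof -
  obtain L where L: "\<And>x y. \<lbrakk>x \<in> K; y \<in> K\<rbrakk> \<Longrightarrow>
      F x \<subseteq> {w + (L * norm (y - x)) *\<^sub>R b | w b. w \<in> F y \<and> b \<in> cball 0 1}"
    using assms unfolding F2_def by meson
  have "\<exists>w\<in>F y. norm (v - w) \<le> \<bar>L\<bar> * norm (y - x)" if xy: "x \<in> K" "y \<in> K" "v \<in> F x" for x y v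
  proof -
    obtain w b where wb: "v = w + (L * norm (y - x)) *\<^sub>R b" "w \<in> F y" "b \<in> cball 0 1"
      using L[OF xy(1,2)] xy(3) by blast
    have "norm (v - w) = \<bar>L\<bar> * norm (y - x) * norm b"
      using wb(1) by (simp add: abs_mult)
    also have "\<dots> \<le> \<bar>L\<bar> * norm (y - x) * 1"
      using wb(3) by (intro mult_left_mono) auto
    finally show ?thesis using wb(2) by auto
  qed
  then show ?thesis using that[of "\<bar>L\<bar>"] by simp
qed

text \<open>The projection of a fixed vector on convex sets is 1/2-Hoelder with respect to the Hausdorff
  distance of the sets.\<close>

lemma continuous_on_closest_point_selection:
  assumes "F1 F" "F2 F" "compact K"
  shows "continuous_on K (\<lambda>x. closest_point (F x) v)"
proof -
  define f where "f x = closest_point (F x) v" for x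
  have F: "F x \<noteq> {}" "closed (F x)" "convex (F x)" for x
    using assms(1) by (auto simp: F1_def compact_imp_closed)
  have fF: "f x \<in> F x" for x
    unfolding f_def using F by (intro closest_point_in_set) auto
  obtain L where "0 \<le> L" and L:
    "\<And>x y v. \<lbrakk>x \<in> K; y \<in> K; v \<in> F x\<rbrakk> \<Longrightarrow> \<exists>w\<in>F y. norm (v - w) \<le> L * norm (y - x)"
    using F2_E[OF assms(2,3)] by metis
  \<comment> \<open>The obtuse angle inequality of the projection holds for points of
    \<open>F x\<close>; \<open>f y\<close> is compared with such a point \<open>u\<close> at
    distance at most \<open>L * norm (x - y)\<close>.\<close>
  have half: "(v - f x) \<bullet> (f y - f x) \<le> norm (v - f x) * (L * norm (y - x))"
    if xy: "x \<in> K" "y \<in> K" for x y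
  proof -
    obtain u where u: "u \<in> F x" "norm (f y - u) \<le> L * norm (x - y)"
      using L[OF xy(2,1) fF] by blast
    have "(v - f x) \<bullet> (u - f x) \<le> 0"
      unfolding f_def using F u(1) by (intro closest_point_dot) auto
    moreover have "(v - f x) \<bullet> (f y - u) \<le> norm (v - f x) * (L * norm (y - x))"
      using u(2) by (metis mult_left_mono norm_cauchy_schwarz norm_ge_zero norm_minus_commute order_trans)
    ultimately show ?thesis by (simp add: inner_diff_right)
  qed
  have est: "norm (f y - f x) \<le> sqrt ((2 * norm (v - f x) + L * norm (y - x)) * (L * norm (y - x)))"
    if xy: "x \<in> K" "y \<in> K" for x y
  proof -
    obtain w where w: "w \<in> F y" "norm (f x - w) \<le> L * norm (y - x)"
      using L[OF xy fF] by blast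
    have "norm (v - f y) \<le> norm (v - w)"
      using closest_point_le[OF F(2) w(1), of v] by (simp add: f_def dist_norm)
    also have "\<dots> \<le> norm (v - f x) + norm (f x - w)"
      using norm_triangle_ineq[of "v - f x" "f x - w"] by simp
    finally have vy: "norm (v - f y) \<le> norm (v - f x) + L * norm (y - x)" using w(2) by simp
    \<comment> \<open>Adding the two angle estimates, one at each projection, bounds the squared
      distance; this is the source of the exponent 1/2.\<close>
    have "(norm (f y - f x))\<^sup>2 = (v - f x) \<bullet> (f y - f x) + (v - f y) \<bullet> (f x - f y)"
      by (simp add: power2_norm_eq_inner inner_diff_left inner_diff_right inner_commute)
    also have "\<dots> \<le> norm (v - f x) * (L * norm (y - x)) + norm (v - f y) * (L * norm (y - x))"
      using half[OF xy] half[OF xy(2,1)] by (simp add: norm_minus_commute)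
    also have "\<dots> \<le> norm (v - f x) * (L * norm (y - x)) + (norm (v - f x) + L * norm (y - x)) * (L * norm (y - x))"
      using vy \<open>0 \<le> L\<close> by (intro add_left_mono mult_right_mono) auto
    also have "\<dots> = (2 * norm (v - f x) + L * norm (y - x)) * (L * norm (y - x))"
      by (simp add: algebra_simps)
    finally show ?thesis by (simp add: real_le_rsqrt)
  qed
  have "(f \<longlongrightarrow> f x) (at x within K)" if x: "x \<in> K" for x
  proof -
    have "((\<lambda>y. sqrt ((2 * norm (v - f x) + L * norm (y - x)) * (L * norm (y - x)))) \<longlongrightarrow>
        sqrt ((2 * norm (v - f x) + L * norm (x - x)) * (L * norm (x - x)))) (at x within K)"
      by (intro tendsto_intros)
    then have "((\<lambda>y. sqrt ((2 * norm (v - f x) + L * norm (y - x)) * (L * norm (y - x)))) \<longlongrightarrow> 0)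
        (at x within K)" by simp
    moreover have "\<forall>\<^sub>F y in at x within K. norm (f y - f x)
        \<le> sqrt ((2 * norm (v - f x) + L * norm (y - x)) * (L * norm (y - x)))"
      unfolding eventually_at_filter by (rule always_eventually) (use est[OF x] in blast)
    ultimately have "((\<lambda>y. f y - f x) \<longlongrightarrow> 0) (at x within K)"
      by (rule Lim_null_comparison[rotated])
    then show ?thesis by (simp add: LIM_zero_iff)
  qed
  then show ?thesis unfolding continuous_on_def f_def by blast
qed

text \<open>Solve the differential equation for the projection \<open>f\<close> of \<open>v\<close>
  on \<open>F x\<close>, a continuous selection with \<open>f \<alpha> = v\<close>.\<close>

lemma trajectory_on_initial_velocity:
  fixes F :: "'a::euclidean_space \<Rightarrow> 'a set"
  assumes "F1 F" "F2 F" "v \<in> F \<alpha>"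
  obtains x \<tau> where "\<tau> > 0" "x 0 = \<alpha>" "(x has_vector_derivative v) (at 0 within {0..\<tau>})"
    "\<And>s. s \<in> {0..\<tau>} \<Longrightarrow> trajectory_on F {0..s} x"
proof -
  define f where "f x = closest_point (F x) v" for x
  have fF: "f x \<in> F x" for x
    unfolding f_def using assms(1) by (intro closest_point_in_set) (auto simp: F1_def compact_imp_closed)
  \<comment> \<open>Composing with this retraction gives a bounded continuous field on the whole
    space, as Peano's theorem requires; it agrees with \<open>f\<close> on the unit ball around
    \<open>\<alpha>\<close>, which the solution does not leave up to time
    \<open>\<tau>\<close>.\<close>
  define \<pi> where "\<pi> = closest_point (cball \<alpha> 1)"
  have \<pi>: "\<pi> x \<in> cball \<alpha> 1" for x
    unfolding \<pi>_def by (rule closest_point_in_set) auto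
  have contf: "continuous_on (cball \<alpha> 1) f"
    unfolding f_def using assms by (intro continuous_on_closest_point_selection) auto
  then have "compact (f ` cball \<alpha> 1)" by (intro compact_continuous_image) auto
  then obtain M where M: "\<And>y. y \<in> cball \<alpha> 1 \<Longrightarrow> norm (f y) \<le> M"
    by (meson bounded_iff compact_imp_bounded imageI)
  have "continuous_on UNIV \<pi>"
    unfolding \<pi>_def by (intro continuous_on_closest_point) auto
  then have "continuous_on UNIV (\<lambda>x. f (\<pi> x))"
    using \<pi> by (intro continuous_on_compose2[OF contf]) auto
  then obtain x where x0: "x 0 = \<alpha>" and
    xd: "\<And>t. t \<in> {0..1} \<Longrightarrow> (x has_vector_derivative f (\<pi> (x t))) (at t within {0..1})"
    using Peano_existence[of "\<lambda>x. f (\<pi> x)" M \<alpha>] M \<pi> by metis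
  have "continuous (at 0 within {0..1}) x"
    using xd[of 0] has_vector_derivative_continuous by auto
  then obtain \<tau>' where "\<tau>' > 0" and \<tau>': "\<And>t. \<lbrakk>t \<in> {0..1}; dist t 0 < \<tau>'\<rbrakk> \<Longrightarrow> dist (x t) (x 0) < 1"
    unfolding continuous_within_eps_delta by (meson zero_less_one)
  define \<tau> where "\<tau> = min 1 (\<tau>' / 2)"
  have \<tau>: "\<tau> > 0" "\<tau> \<le> 1" using \<open>\<tau>' > 0\<close> by (auto simp: \<tau>_def)
  have ball: "x t \<in> cball \<alpha> 1" if "t \<in> {0..\<tau>}" for t
    using \<tau>'[of t] that \<open>\<tau>' > 0\<close> x0 by (auto simp: \<tau>_def dist_commute)
  have d: "(x has_vector_derivative f (x t)) (at t within {0..s})" if "t \<in> {0..s}" "s \<in> {0..\<tau>}" for s t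
  proof -
    have "\<pi> (x t) = x t"
      unfolding \<pi>_def using ball[of t] that by (intro closest_point_self) auto
    then show ?thesis
      using has_vector_derivative_within_subset[OF xd[of t]] that \<tau> by auto
  qed
  show ?thesis
  proof (rule that[of \<tau> x, OF \<tau>(1) x0])
    have "f \<alpha> = v" unfolding f_def using assms(3) by (rule closest_point_self)
    then show "(x has_vector_derivative v) (at 0 within {0..\<tau>})"
      using d[of 0 \<tau>] \<tau> x0 by simp
    fix s assume s: "s \<in> {0..\<tau>}"
    have "norm (x t - x r) \<le> M * norm (t - r)" if "r \<in> {0..s}" "t \<in> {0..s}" for r t
    proof (rule differentiable_bound[of "{0..s}"])
      fix u assume u: "u \<in> {0..s}"
      show "(x has_derivative (\<lambda>h. h *\<^sub>R f (x u))) (at u within {0..s})"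
        using d[OF u s] by (simp add: has_vector_derivative_def)
      have "norm (f (x u)) \<le> M" using u s by (intro M ball) auto
      then show "onorm (\<lambda>h. h *\<^sub>R f (x u)) \<le> M"
        by (intro onorm_le) (simp add: mult.commute[of M] mult_left_mono)
    qed (use that in auto)
    then have "abs_cont_on {0..s} x"
      by (intro lipschitz_imp_abs_cont_on[of _ _ M]) auto
    then show "trajectory_on F {0..s} x"
      unfolding trajectory_on_def using d[OF _ s] fF by (auto intro!: AE_I2)
  qed
qed

text \<open>The speed bound holds only inside the ball, so the trajectory is followed to its first
  exit time: by then it has moved at most \<open>M * \<tau>\<close>, too little to reach the
  boundary.\<close>

lemma trajectory_on_stays_near:
  fixes F :: "'a::euclidean_space \<Rightarrow> 'a set"
  assumes x: "trajectory_on F {0..\<tau>} x"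
    and M: "0 \<le> M" "\<And>y v. \<lbrakk>y \<in> ball \<alpha> \<rho>; v \<in> F y\<rbrakk> \<Longrightarrow> norm v \<le> M"
    and small: "norm (x 0 - \<alpha>) + M * \<tau> < \<rho>" and t: "t \<in> {0..\<tau>}"
  shows "x t \<in> ball \<alpha> \<rho>"
proof (rule ccontr)
  assume nt: "x t \<notin> ball \<alpha> \<rho>"
  define A where "A = {s \<in> {0..\<tau>}. \<rho> \<le> norm (x s - \<alpha>)}"
  have AC: "abs_cont_on {0..\<tau>} x" using x by (simp add: trajectory_on_def)
  have "continuous_on {0..\<tau>} (\<lambda>s. norm (x s - \<alpha>))"
    by (intro continuous_intros abs_cont_on_imp_continuous_on AC)
  then have "closed A"
    unfolding A_def by (intro continuous_on_closed_Collect_le continuous_on_const) auto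
  moreover have "A \<noteq> {}" using nt t by (auto simp: A_def dist_norm norm_minus_commute)
  moreover have "bdd_below A" by (auto simp: A_def)
  ultimately have "Inf A \<in> A" by (intro closed_contains_Inf)
  define s where "s = Inf A"
  have s: "s \<in> {0..\<tau>}" "\<rho> \<le> norm (x s - \<alpha>)" using \<open>Inf A \<in> A\<close> by (auto simp: A_def s_def)
  have before: "x r \<in> ball \<alpha> \<rho>" if "r \<in> {0..s}" "r \<noteq> s" for r
  proof (rule ccontr)
    assume "x r \<notin> ball \<alpha> \<rho>"
    then have "r \<in> A" using that s by (auto simp: A_def dist_norm norm_minus_commute)
    then have "s \<le> r" unfolding s_def using \<open>bdd_below A\<close> by (rule cInf_lower)
    then show False using that by auto
  qed
  have "norm (x s - x 0) \<le> M * (s - 0)"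
  proof (rule abs_cont_on_norm_increment_le[OF _ _ M(1)])
    show "abs_cont_on {0..s} x" using s by (intro abs_cont_on_subset[OF AC]) auto
    have "AE r in lebesgue. r \<noteq> s" by (rule AE_I'[of "{s}"]) auto
    moreover have "AE r in lebesgue. r \<in> {0..\<tau>} \<longrightarrow>
        (\<exists>v\<in>F (x r). (x has_vector_derivative v) (at r within {0..\<tau>}))"
      using x by (simp add: trajectory_on_def)
    ultimately show "AE r in lebesgue. r \<in> {0..s} \<longrightarrow>
        (\<exists>v. (x has_vector_derivative v) (at r within {0..s}) \<and> norm v \<le> M)"
    proof eventually_elim
      case (elim r)
      show ?case
      proof
        assume r: "r \<in> {0..s}"
        then obtain v where v: "v \<in> F (x r)" "(x has_vector_derivative v) (at r within {0..\<tau>})"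
          using elim s by auto
        then have "(x has_vector_derivative v) (at r within {0..s})"
          using s by (intro has_vector_derivative_within_subset[OF v(2)]) auto
        moreover have "norm v \<le> M" using M(2) before r elim(1) v(1) by blast
        ultimately show "\<exists>v. (x has_vector_derivative v) (at r within {0..s}) \<and> norm v \<le> M" by blast
      qed
    qed
  qed (use s in auto)
  also have "\<dots> \<le> M * \<tau>" using s M(1) by (intro mult_left_mono) auto
  finally have "norm (x s - x 0) \<le> M * \<tau>" .
  moreover have "norm (x s - \<alpha>) \<le> norm (x s - x 0) + norm (x 0 - \<alpha>)"
    using norm_triangle_ineq[of "x s - x 0" "x 0 - \<alpha>"] by simp
  ultimately show False using s small by linarith
qed

section \<open>Singular subgradients of the minimal time function on the diagonal\<close>

lemma hamiltonian_nonneg_iff: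
  assumes "F1 F"
  shows "0 \<le> hamiltonian F x p \<longleftrightarrow> (\<forall>v\<in>F x. 0 \<le> v \<bullet> p)"
proof -
  obtain v where "v \<in> F x" "hamiltonian F x p = v \<bullet> p" "\<forall>w\<in>F x. v \<bullet> p \<le> w \<bullet> p"
    using hamiltonian_is_min[OF assms] by blast
  then show ?thesis by (metis order_trans)
qed

text \<open>The base point of the epigraph has height 0 since the minimal time vanishes on the
  diagonal; the height \<open>\<mu>\<close> enters only through the norm, as the normal is
  horizontal.\<close>

lemma frechet_singular_subdiff_min_time_iff:
  "(\<zeta>, \<xi>) \<in> frechet_singular_subdiff (min_time F) (\<alpha>, \<alpha>) \<longleftrightarrow>
    (\<forall>\<epsilon>>0. \<exists>\<delta>>0. \<forall>a b \<mu>. min_time F (a, b) \<le> ereal \<mu> \<longrightarrow> norm ((a - \<alpha>, b - \<alpha>), \<mu>) < \<delta> \<longrightarrow>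
      \<zeta> \<bullet> (a - \<alpha>) + \<xi> \<bullet> (b - \<alpha>) \<le> \<epsilon> * norm ((a - \<alpha>, b - \<alpha>), \<mu>))"
proof -
  have "min_time F (a, b) < \<infinity> \<and> min_time F (a, b) \<le> ereal \<mu> \<longleftrightarrow> min_time F (a, b) \<le> ereal \<mu>" for a b \<mu>
    by auto
  then show ?thesis
    unfolding frechet_singular_subdiff_def frechet_normal_cone_def epi_def
    by (simp add: min_time_refl)
qed

lemma min_time_le:
  assumes "trajectory_on F {0..s} x" "0 \<le> s"
  shows "min_time F (x 0, x s) \<le> ereal s"
  unfolding min_time_def using assms by (auto intro!: Inf_lower)

lemma min_time_lessE:
  assumes "min_time F (a, b) < ereal s"
  obtains \<tau> x where "0 \<le> \<tau>" "\<tau> < s" "trajectory_on F {0..\<tau>} x" "x 0 = a" "x \<tau> = b"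
  using assms unfolding min_time_def by (auto simp: Inf_less_iff)

text \<open>Moving both points by \<open>s *\<^sub>R u\<close> with
  \<open>u = \<zeta> + \<xi>\<close> stays on the diagonal at height 0, and the pairing with the
  normal is \<open>s\<close> times the square of \<open>norm u\<close>.\<close>

lemma singular_subdiff_min_time_antisym:
  assumes "(\<zeta>, \<xi>) \<in> frechet_singular_subdiff (min_time F) (\<alpha>, \<alpha>)"
  shows "\<xi> = - \<zeta>"
proof (rule ccontr)
  define u where "u = \<zeta> + \<xi>"
  assume "\<xi> \<noteq> - \<zeta>"
  then have u: "norm u > 0" by (simp add: u_def add_eq_0_iff)
  then obtain \<delta> where "\<delta> > 0" and \<delta>: "\<And>a b \<mu>. \<lbrakk>min_time F (a, b) \<le> ereal \<mu>; norm ((a - \<alpha>, b - \<alpha>), \<mu>) < \<delta>\<rbrakk> \<Longrightarrow>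
      \<zeta> \<bullet> (a - \<alpha>) + \<xi> \<bullet> (b - \<alpha>) \<le> norm u / 4 * norm ((a - \<alpha>, b - \<alpha>), \<mu>)"
    using assms[unfolded frechet_singular_subdiff_min_time_iff, rule_format, of "norm u / 4"] by auto
  \<comment> \<open>The test vector has norm at most \<open>2 * s * norm u\<close>, that is
    \<open>\<delta> / 2\<close>; with the tolerance \<open>norm u / 4\<close> the pairing is then at
    most half of itself.\<close>
  define s where "s = \<delta> / (4 * norm u)"
  have "s > 0" using u \<open>\<delta> > 0\<close> by (simp add: s_def)
  have n: "norm ((s *\<^sub>R u, s *\<^sub>R u), 0::real) \<le> 2 * s * norm u"
    using norm_Pair_le[of "s *\<^sub>R u" "s *\<^sub>R u"] \<open>s > 0\<close> by (simp add: norm_Pair)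
  also have "\<dots> < \<delta>" using u \<open>\<delta> > 0\<close> by (simp add: s_def)
  finally have "\<zeta> \<bullet> (s *\<^sub>R u) + \<xi> \<bullet> (s *\<^sub>R u) \<le> norm u / 4 * norm ((s *\<^sub>R u, s *\<^sub>R u), 0::real)"
    using \<delta>[of "\<alpha> + s *\<^sub>R u" "\<alpha> + s *\<^sub>R u" 0] by (simp add: min_time_refl)
  also have "\<dots> \<le> norm u / 4 * (2 * s * norm u)"
    using n by (intro mult_left_mono) auto
  also have "\<zeta> \<bullet> (s *\<^sub>R u) + \<xi> \<bullet> (s *\<^sub>R u) = (\<zeta> + \<xi>) \<bullet> (s *\<^sub>R u)"
    by (rule inner_add_left[symmetric])
  also have "\<dots> = s * (norm u)\<^sup>2"
    by (simp add: u_def[symmetric] power2_norm_eq_inner)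
  finally have "s * (norm u)\<^sup>2 \<le> s * (norm u)\<^sup>2 / 2"
    by (simp add: power2_eq_square)
  moreover have "s * (norm u)\<^sup>2 > 0" using u \<open>s > 0\<close> by simp
  ultimately show False by linarith
qed

text \<open>Along a trajectory starting with velocity \<open>v\<close>, the pairing with the normal
  is \<open>- s * (v \<bullet> \<zeta>)\<close> up to o(s), while the test vector has norm O(s); a
  negative \<open>v \<bullet> \<zeta>\<close> would violate the normal inequality.\<close>

lemma singular_subdiff_min_time_velocity:
  fixes F :: "'a::euclidean_space \<Rightarrow> 'a set"
  assumes "F1 F" "F2 F" "(\<zeta>, - \<zeta>) \<in> frechet_singular_subdiff (min_time F) (\<alpha>, \<alpha>)" and v: "v \<in> F \<alpha>"
  shows "0 \<le> v \<bullet> \<zeta>"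
proof (rule ccontr)
  assume "\<not> 0 \<le> v \<bullet> \<zeta>"
  define c where "c = - (v \<bullet> \<zeta>)"
  have "c > 0" using \<open>\<not> 0 \<le> v \<bullet> \<zeta>\<close> by (simp add: c_def)
  \<comment> \<open>The first-order error of the trajectory then costs less than half of
    \<open>c * s\<close>.\<close>
  define \<eta> where "\<eta> = c / (2 * (norm \<zeta> + 1))"
  have \<zeta>1: "norm \<zeta> + 1 > 0" using norm_ge_zero[of \<zeta>] by linarith
  have \<eta>: "\<eta> > 0" "norm \<zeta> * \<eta> < c / 2"
    using \<open>c > 0\<close> \<zeta>1 by (auto simp: \<eta>_def field_simps)
  \<comment> \<open>\<open>B * s\<close> bounds the norm of the test vector: displacement at most
    \<open>(norm v + \<eta>) * s\<close>, height \<open>s\<close>. The tolerance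
    \<open>c / (2 * B)\<close> thus leaves at most \<open>c / 2 * s\<close>.\<close>
  define B where "B = norm v + \<eta> + 1"
  have "B > 0" using \<eta>(1) norm_ge_zero[of v] unfolding B_def by linarith
  then have "c / (2 * B) > 0" using \<open>c > 0\<close> by simp
  then obtain \<delta> where "\<delta> > 0" and \<delta>: "\<And>a b \<mu>. \<lbrakk>min_time F (a, b) \<le> ereal \<mu>; norm ((a - \<alpha>, b - \<alpha>), \<mu>) < \<delta>\<rbrakk> \<Longrightarrow>
      \<zeta> \<bullet> (a - \<alpha>) + (- \<zeta>) \<bullet> (b - \<alpha>) \<le> c / (2 * B) * norm ((a - \<alpha>, b - \<alpha>), \<mu>)"
    using assms(3)[unfolded frechet_singular_subdiff_min_time_iff, rule_format, of "c / (2 * B)"] by auto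
  obtain x \<tau> where "\<tau> > 0" and x0: "x 0 = \<alpha>" and xd: "(x has_vector_derivative v) (at 0 within {0..\<tau>})"
    and traj: "\<And>s. s \<in> {0..\<tau>} \<Longrightarrow> trajectory_on F {0..s} x"
    using trajectory_on_initial_velocity[OF assms(1,2) v] by metis
  obtain d where "d > 0" and d: "\<And>s. \<lbrakk>s \<in> {0..\<tau>}; \<bar>s\<bar> < d\<rbrakk> \<Longrightarrow> norm (x s - \<alpha> - s *\<^sub>R v) \<le> \<eta> * \<bar>s\<bar>"
    using xd \<eta>(1) x0 unfolding has_vector_derivative_def has_derivative_within_alt
    by (metis diff_zero real_norm_def)
  define s where "s = min \<tau> (min (d / 2) (\<delta> / (2 * B)))"
  have s: "s > 0" "s \<in> {0..\<tau>}" "\<bar>s\<bar> < d" "s \<le> \<delta> / (2 * B)"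
    using \<open>\<tau> > 0\<close> \<open>d > 0\<close> \<open>\<delta> > 0\<close> \<open>B > 0\<close> by (auto simp: s_def)
  have near: "norm (x s - \<alpha> - s *\<^sub>R v) \<le> \<eta> * s" using d[OF s(2,3)] s(1) by simp
  have "norm (x s - \<alpha>) \<le> norm (s *\<^sub>R v) + norm (x s - \<alpha> - s *\<^sub>R v)" by (rule norm_triangle_sub)
  then have "norm (x s - \<alpha>) \<le> s * norm v + \<eta> * s" using near s(1) by simp
  moreover have "norm ((x 0 - \<alpha>, x s - \<alpha>), s) \<le> norm (x s - \<alpha>) + s"
    using norm_Pair_le[of "(x 0 - \<alpha>, x s - \<alpha>)" s] s(1) x0 by (simp add: norm_Pair)
  ultimately have n: "norm ((x 0 - \<alpha>, x s - \<alpha>), s) \<le> B * s" by (simp add: B_def algebra_simps)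
  also have "\<dots> \<le> \<delta> / 2" using s(4) \<open>B > 0\<close> by (simp add: field_simps)
  also have "\<dots> < \<delta>" using \<open>\<delta> > 0\<close> by simp
  finally have "- (\<zeta> \<bullet> (x s - \<alpha>)) \<le> c / (2 * B) * norm ((x 0 - \<alpha>, x s - \<alpha>), s)"
    using \<delta>[of "x 0" "x s" s] min_time_le[OF traj[OF s(2)]] s(1) x0 by simp
  also have "\<dots> \<le> c / (2 * B) * (B * s)"
    using n \<open>c / (2 * B) > 0\<close> by (intro mult_left_mono) auto
  also have "\<dots> = c / 2 * s" using \<open>B > 0\<close> by simp
  finally have upper: "- (\<zeta> \<bullet> (x s - \<alpha>)) \<le> c / 2 * s" .
  have "\<zeta> \<bullet> (x s - \<alpha> - s *\<^sub>R v) \<le> norm \<zeta> * (\<eta> * s)"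
    using near by (meson norm_cauchy_schwarz mult_left_mono norm_ge_zero order_trans)
  moreover have "norm \<zeta> * \<eta> * s < c / 2 * s" using \<eta>(2) s(1) by (rule mult_strict_right_mono)
  moreover have "\<zeta> \<bullet> (s *\<^sub>R v) = - (c * s)" by (simp add: c_def inner_commute)
  ultimately show False using upper by (simp add: inner_diff_right mult.assoc)
qed

text \<open>Near \<open>\<alpha>\<close> every velocity is close to one in
  \<open>F \<alpha>\<close>, so \<open>- \<zeta>\<close> grows along short trajectories at rate at
  most \<open>\<epsilon>\<close>; the growth condition confines these trajectories to that
  neighbourhood.\<close>

lemma singular_subdiff_min_timeI:
  fixes F :: "'a::euclidean_space \<Rightarrow> 'a set"
  assumes "F2 F" "F3 F" and \<zeta>: "\<And>v. v \<in> F \<alpha> \<Longrightarrow> 0 \<le> v \<bullet> \<zeta>"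
  shows "(\<zeta>, - \<zeta>) \<in> frechet_singular_subdiff (min_time F) (\<alpha>, \<alpha>)"
  unfolding frechet_singular_subdiff_min_time_iff
proof (intro allI impI)
  fix \<epsilon> :: real assume "\<epsilon> > 0"
  obtain L where "0 \<le> L" and L: "\<And>x y v. \<lbrakk>x \<in> cball \<alpha> 1; y \<in> cball \<alpha> 1; v \<in> F x\<rbrakk> \<Longrightarrow>
      \<exists>w\<in>F y. norm (v - w) \<le> L * norm (y - x)"
    using F2_E[OF assms(1) compact_cball] by metis
  obtain \<gamma> c where "\<gamma> > 0" "c > 0" and growth: "\<And>x v. v \<in> F x \<Longrightarrow> norm v \<le> \<gamma> * norm x + c"
    using assms(2) unfolding F3_def by blast
  define M where "M = \<gamma> * (norm \<alpha> + 1) + c"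
  have "M \<ge> 0" using \<open>\<gamma> > 0\<close> \<open>c > 0\<close> by (simp add: M_def)
  define C where "C = norm \<zeta> * L"
  have "C \<ge> 0" using \<open>0 \<le> L\<close> by (simp add: C_def)
  \<comment> \<open>Radius at most 1, where the Lipschitz constant \<open>L\<close> is valid, and
    small enough that replacing a velocity by one in \<open>F \<alpha>\<close> costs at most
    \<open>C * \<rho> \<le> \<epsilon>\<close>.\<close>
  define \<rho> where "\<rho> = min 1 (\<epsilon> / (C + 1))"
  have \<rho>: "\<rho> > 0" "\<rho> \<le> 1" using \<open>\<epsilon> > 0\<close> \<open>C \<ge> 0\<close> by (auto simp: \<rho>_def)
  have C\<rho>: "C * \<rho> \<le> \<epsilon>"
  proof -
    have "C * \<rho> \<le> C * (\<epsilon> / (C + 1))" using \<open>C \<ge> 0\<close> by (intro mult_left_mono) (auto simp: \<rho>_def)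
    also have "\<dots> \<le> \<epsilon>" using \<open>\<epsilon> > 0\<close> \<open>C \<ge> 0\<close> by (simp add: field_simps)
    finally show ?thesis .
  qed
  have Mbd: "norm v \<le> M" if "y \<in> ball \<alpha> \<rho>" "v \<in> F y" for y v
  proof -
    have "norm y \<le> norm \<alpha> + norm (y - \<alpha>)" by (rule norm_triangle_sub)
    also have "\<dots> \<le> norm \<alpha> + 1" using that(1) \<rho> by (simp add: dist_norm norm_minus_commute)
    finally have "\<gamma> * norm y \<le> \<gamma> * (norm \<alpha> + 1)" using \<open>\<gamma> > 0\<close> by (intro mult_left_mono) auto
    then show ?thesis using growth[OF that(2)] by (simp add: M_def)
  qed
  \<comment> \<open>Initial offset below \<open>\<delta>\<close> plus travel at speed at most
    \<open>M\<close> for time at most \<open>\<delta>\<close> remains inside radius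
    \<open>\<rho>\<close>.\<close>
  define \<delta> where "\<delta> = \<rho> / (M + 2)"
  have "\<delta> > 0" using \<rho> \<open>M \<ge> 0\<close> by (simp add: \<delta>_def)
  have \<delta>\<rho>: "\<delta> + M * \<delta> < \<rho>"
  proof -
    have "(M + 2) * \<delta> = \<rho>" using \<open>M \<ge> 0\<close> by (simp add: \<delta>_def)
    then show ?thesis using \<open>\<delta> > 0\<close> by (simp add: algebra_simps)
  qed
  have short: "\<zeta> \<bullet> (x 0 - x \<tau>) \<le> \<epsilon> * \<tau>"
    if x: "trajectory_on F {0..\<tau>} x" "0 \<le> \<tau>" "\<tau> \<le> \<delta>" "norm (x 0 - \<alpha>) < \<delta>" for x \<tau>
  proof -
    have "M * \<tau> \<le> M * \<delta>" using x(3) \<open>M \<ge> 0\<close> by (rule mult_left_mono)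
    then have "norm (x 0 - \<alpha>) + M * \<tau> < \<rho>" using x(4) \<delta>\<rho> by linarith
    then have near: "x t \<in> ball \<alpha> \<rho>" if "t \<in> {0..\<tau>}" for t
      using trajectory_on_stays_near[OF x(1) \<open>M \<ge> 0\<close>] Mbd that by blast
    have vel: "(- \<zeta>) \<bullet> v \<le> \<epsilon>" if tv: "t \<in> {0..\<tau>}" "v \<in> F (x t)" for t v
    proof -
      have xt: "norm (\<alpha> - x t) < \<rho>" using near[OF tv(1)] by (simp add: dist_norm)
      then obtain w where w: "w \<in> F \<alpha>" "norm (v - w) \<le> L * norm (\<alpha> - x t)"
        using L[of "x t" \<alpha> v] tv(2) \<rho> by (auto simp: dist_norm)
      have "norm (w - v) \<le> L * \<rho>"
        using w(2) xt \<open>0 \<le> L\<close> by (metis less_imp_le mult_left_mono norm_minus_commute order_trans)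
      then have "\<zeta> \<bullet> (w - v) \<le> norm \<zeta> * (L * \<rho>)"
        by (meson norm_cauchy_schwarz mult_left_mono norm_ge_zero order_trans)
      also have "\<dots> \<le> \<epsilon>" using C\<rho> by (simp add: C_def mult.assoc)
      finally show ?thesis using \<zeta>[OF w(1)] by (simp add: inner_diff_right inner_commute)
    qed
    have "(- \<zeta>) \<bullet> (x \<tau> - x 0) \<le> \<epsilon> * (\<tau> - 0)"
    proof (rule abs_cont_on_inner_increment_le[OF x(2)])
      show "abs_cont_on {0..\<tau>} x" using x(1) by (simp add: trajectory_on_def)
      have "AE t in lebesgue. t \<in> {0..\<tau>} \<longrightarrow>
          (\<exists>v\<in>F (x t). (x has_vector_derivative v) (at t within {0..\<tau>}))"
        using x(1) by (simp add: trajectory_on_def)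
      then show "AE t in lebesgue. t \<in> {0..\<tau>} \<longrightarrow>
          (\<exists>v. (x has_vector_derivative v) (at t within {0..\<tau>}) \<and> (- \<zeta>) \<bullet> v \<le> \<epsilon>)"
        by (rule eventually_mono) (use vel in blast)
    qed
    then show ?thesis by (simp add: inner_diff_right)
  qed
  have "\<zeta> \<bullet> (a - \<alpha>) + (- \<zeta>) \<bullet> (b - \<alpha>) \<le> \<epsilon> * norm ((a - \<alpha>, b - \<alpha>), \<mu>)"
    if T: "min_time F (a, b) \<le> ereal \<mu>" and n: "norm ((a - \<alpha>, b - \<alpha>), \<mu>) < \<delta>" for a b \<mu>
  proof -
    have \<mu>: "\<bar>\<mu>\<bar> \<le> norm ((a - \<alpha>, b - \<alpha>), \<mu>)"
      using norm_snd_le[of \<mu>] by simp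
    have "norm (a - \<alpha>) \<le> norm (a - \<alpha>, b - \<alpha>)"
      by (rule norm_fst_le)
    also have "\<dots> \<le> norm ((a - \<alpha>, b - \<alpha>), \<mu>)"
      by (rule norm_fst_le)
    finally have a: "norm (a - \<alpha>) < \<delta>" using n by simp
    have "\<zeta> \<bullet> (a - b) \<le> \<epsilon> * \<mu>"
    proof (rule field_le_epsilon)
      fix e :: real assume "e > 0"
      \<comment> \<open>The infimum is only approximated, so \<open>\<mu>\<close> is exceeded by a
        slack \<open>\<eta>\<close>: it costs at most \<open>e\<close> after multiplication by
        \<open>\<epsilon>\<close> and keeps the duration below \<open>\<delta>\<close>.\<close>
      define \<eta> where "\<eta> = min (e / \<epsilon>) (\<delta> - \<mu>)"
      have \<eta>: "\<eta> > 0" "\<eta> \<le> e / \<epsilon>" "\<mu> + \<eta> \<le> \<delta>"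
        using \<open>e > 0\<close> \<open>\<epsilon> > 0\<close> \<mu> n by (auto simp: \<eta>_def)
      have "min_time F (a, b) < ereal (\<mu> + \<eta>)"
        using T \<eta>(1) by (auto intro: le_less_trans)
      then obtain \<tau> x where \<tau>: "0 \<le> \<tau>" "\<tau> < \<mu> + \<eta>" "trajectory_on F {0..\<tau>} x" "x 0 = a" "x \<tau> = b"
        by (rule min_time_lessE)
      then have "\<zeta> \<bullet> (a - b) \<le> \<epsilon> * \<tau>"
        using short[OF \<tau>(3,1)] \<eta>(3) a by simp
      also have "\<dots> \<le> \<epsilon> * (\<mu> + e / \<epsilon>)"
        using \<tau>(2) \<eta>(2) \<open>\<epsilon> > 0\<close> by (intro mult_left_mono) auto
      also have "\<dots> = \<epsilon> * \<mu> + e" using \<open>\<epsilon> > 0\<close> by (simp add: field_simps)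
      finally show "\<zeta> \<bullet> (a - b) \<le> \<epsilon> * \<mu> + e" .
    qed
    also have "\<dots> \<le> \<epsilon> * norm ((a - \<alpha>, b - \<alpha>), \<mu>)"
      using \<mu> \<open>\<epsilon> > 0\<close> by (intro mult_left_mono) auto
    finally show ?thesis by (simp add: inner_diff_right)
  qed
  then show "\<exists>\<delta>>0. \<forall>a b \<mu>. min_time F (a, b) \<le> ereal \<mu> \<longrightarrow> norm ((a - \<alpha>, b - \<alpha>), \<mu>) < \<delta> \<longrightarrow>
      \<zeta> \<bullet> (a - \<alpha>) + (- \<zeta>) \<bullet> (b - \<alpha>) \<le> \<epsilon> * norm ((a - \<alpha>, b - \<alpha>), \<mu>)"
    using \<open>\<delta> > 0\<close> by blast
qed

theorem theorem3p4:
  fixes F :: "real ^ 'n \<Rightarrow> (real ^ 'n) set" and \<alpha> :: "real ^ 'n"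
  assumes "F1 F" and "F2 F" and "F3 F"
  shows "frechet_singular_subdiff (min_time F) (\<alpha>, \<alpha>) =
    {(\<zeta>, - \<zeta>) | \<zeta>. hamiltonian F \<alpha> \<zeta> \<ge> 0}"
proof (intro subset_antisym subsetI)
  fix p assume p: "p \<in> frechet_singular_subdiff (min_time F) (\<alpha>, \<alpha>)"
  obtain \<zeta> \<xi> where "p = (\<zeta>, \<xi>)" by fastforce
  with p singular_subdiff_min_time_antisym have "p = (\<zeta>, - \<zeta>)" by blast
  then show "p \<in> {(\<zeta>, - \<zeta>) | \<zeta>. hamiltonian F \<alpha> \<zeta> \<ge> 0}"
    using singular_subdiff_min_time_velocity[OF assms(1,2)] p hamiltonian_nonneg_iff[OF assms(1)] by blast
next
  fix p assume "p \<in> {(\<zeta>, - \<zeta>) | \<zeta>. hamiltonian F \<alpha> \<zeta> \<ge> 0}"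
  then obtain \<zeta> where "p = (\<zeta>, - \<zeta>)" "\<forall>v\<in>F \<alpha>. 0 \<le> v \<bullet> \<zeta>"
    using hamiltonian_nonneg_iff[OF assms(1)] by blast
  then show "p \<in> frechet_singular_subdiff (min_time F) (\<alpha>, \<alpha>)"
    using singular_subdiff_min_timeI[OF assms(2,3)] by blast
qed

end
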